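(* Let $q\in(1,M+1]$ and $x\in J_q$. Then: (i) $x\in\mathcal U_q$ iff $x$ has a unique expansion in base $q$; (ii) $x\in\overline{\mathcal U_q}$ iff at least one of $x$ and $M/(q-1)-x$ has a unique infinite expansion in base $q$; (iii) $x\in\mathcal V_q$ iff $x$ has at most one doubly infinite expansion in base $q$.
   Context: Fix a positive integer $M$, $A=\{0,1,\dots,M\}$, sequences are elements of $A^{\mathbb N}$ ordered lexicographically; $\overline c=M-c$, digitwise for sequences. A sequence is finite if it has a last nonzero digit, infinite otherwise; doubly infinite if both it and its reflection are infinite. For $q\in(1,M+1]$ an expansion of $x$ in base $q$ is $(c_i)\in A^{\mathbb N}$ with $\sum c_iq^{-i}=x$; $J_q=[0,M/(q-1)]$. $a(x,q)$ is the lexicographically largest infinite expansion of $x$; $\alpha(q)=(\alpha_i)=a(1,q)$. $\mathcal U_q$ is the set of $x\in J_q$ with a unique expansion, $\overline{\mathcal U_q}$ its closure. Here $\mathcal V_q'$ is defined as the set of infinite sequences $(c_i)\in A^{\mathbb N}$ such that $c_{n+1}c_{n+2}\cdots\le\alpha_1\alpha_2\cdots$ whenever $c_n<M$, and $\overline{c_{n+1}c_{n+2}\cdots}\le\alpha_1\alpha_2\cdots$ whenever $c_n>0$; and $\mathcal V_q=\{\sum_i c_iq^{-i}:(c_i)\in\mathcal V_q'\}$. *)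

theory Defs
  imports "HOL-Analysis.Analysis" "HOL-Library.Fun_Lexorder"
begin

text \<open>
  Sequences \<open>(c\<^sub>i)\<close> with \<open>i \<ge> 1\<close> are represented as functions \<open>c :: nat \<Rightarrow> nat\<close> indexed from 0,
  so the digit \<open>c\<^sub>i\<close> is \<open>c (i - 1)\<close> and carries the weight \<open>q\<^bsup>-i\<^esup>\<close>.
\<close>

definition digit_seqs :: "nat \<Rightarrow> (nat \<Rightarrow> nat) set" where
  "digit_seqs M = (UNIV \<rightarrow> {0..M})"

definition lex_le :: "(nat \<Rightarrow> nat) \<Rightarrow> (nat \<Rightarrow> nat) \<Rightarrow> bool" where
  "lex_le c d \<longleftrightarrow> less_fun c d \<or> c = d"

definition reflect :: "nat \<Rightarrow> (nat \<Rightarrow> nat) \<Rightarrow> nat \<Rightarrow> nat" where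
  "reflect M c = (\<lambda>i. M - c i)"

definition shift :: "nat \<Rightarrow> (nat \<Rightarrow> nat) \<Rightarrow> nat \<Rightarrow> nat" where
  "shift n c = (\<lambda>i. c (n + i))"

text \<open>The zero sequence has no last nonzero digit, hence counts as infinite.\<close>

definition finite_seq :: "(nat \<Rightarrow> nat) \<Rightarrow> bool" where
  "finite_seq c \<longleftrightarrow> (\<exists>n. c n \<noteq> 0 \<and> (\<forall>m>n. c m = 0))"

definition infinite_seq :: "(nat \<Rightarrow> nat) \<Rightarrow> bool" where
  "infinite_seq c \<longleftrightarrow> \<not> finite_seq c"

definition doubly_infinite_seq :: "nat \<Rightarrow> (nat \<Rightarrow> nat) \<Rightarrow> bool" where
  "doubly_infinite_seq M c \<longleftrightarrow> infinite_seq c \<and> infinite_seq (reflect M c)"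

definition is_expansion :: "nat \<Rightarrow> real \<Rightarrow> real \<Rightarrow> (nat \<Rightarrow> nat) \<Rightarrow> bool" where
  "is_expansion M q x c \<longleftrightarrow>
     c \<in> digit_seqs M \<and> (\<lambda>i. real (c i) / q ^ Suc i) sums x"

definition J_set :: "nat \<Rightarrow> real \<Rightarrow> real set" where
  "J_set M q = {0..real M / (q - 1)}"

definition quasi_greedy :: "nat \<Rightarrow> real \<Rightarrow> real \<Rightarrow> nat \<Rightarrow> nat" where
  "quasi_greedy M x q = (THE c. is_expansion M q x c \<and> infinite_seq c \<and>
     (\<forall>d. is_expansion M q x d \<and> infinite_seq d \<longrightarrow> lex_le d c))"

definition alpha :: "nat \<Rightarrow> real \<Rightarrow> nat \<Rightarrow> nat" where
  "alpha M q = quasi_greedy M 1 q"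

definition U_set :: "nat \<Rightarrow> real \<Rightarrow> real set" where
  "U_set M q = {x \<in> J_set M q. \<exists>!c. is_expansion M q x c}"

definition V_seqs :: "nat \<Rightarrow> real \<Rightarrow> (nat \<Rightarrow> nat) set" where
  "V_seqs M q = {c \<in> digit_seqs M. infinite_seq c \<and>
     (\<forall>n. c n < M \<longrightarrow> lex_le (shift (Suc n) c) (alpha M q)) \<and>
     (\<forall>n. c n > 0 \<longrightarrow> lex_le (reflect M (shift (Suc n) c)) (alpha M q))}"

definition V_set :: "nat \<Rightarrow> real \<Rightarrow> real set" where
  "V_set M q = (\<lambda>c. \<Sum>i. real (c i) / q ^ Suc i) ` V_seqs M q"

end

theory Submission
  imports Defs
begin

text \<open>
  The quasi-greedy expansion of \<open>x\<close> is the infinite expansion whose tails have value at most \<open>1\<close>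
  after every digit below \<open>M\<close>; it is the largest infinite expansion, and the reflected quasi-greedy
  expansion of \<open>M/(q-1) - x\<close> is the smallest co-infinite one. Membership in \<open>V\<^sub>q\<close> means that the two
  coincide, which gives (iii).

  If \<open>x\<close> has two infinite expansions, then lowering their positive tails after the first difference
  yields two expansions of every \<open>y\<close> slightly below \<open>x\<close>, so \<open>x\<close> is no limit of univoque points from
  the left. With reflection this gives one direction of (ii). Conversely, if \<open>x\<close> has a unique
  infinite expansion \<open>c\<close> and also a finite one, then \<open>c\<close> ends in \<open>\<alpha>(q)\<close>, and uniqueness forces
  strict inequality in all lower lexicographic conditions on \<open>\<alpha>(q)\<close>. Such a sequence is the limit from below
  of periodic sequences \<open>(\<alpha>\<^sub>1\<dots>\<alpha>\<^sub>n\<^sub>-\<^sub>1(\<alpha>\<^sub>n-1))\<^sup>\<infinity>\<close> satisfying the weak conditions with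
  respect to themselves; substituting them for the final \<open>\<alpha>(q)\<close> in \<open>c\<close> gives univoque points
  converging to \<open>x\<close>.
\<close>

section \<open>Lexicographic order, infinite sequences, splicing and reflection\<close>

lemma first_diff:
  fixes c d :: "nat \<Rightarrow> nat"
  assumes "c \<noteq> d"
  obtains k where "c k \<noteq> d k" "\<And>i. i < k \<Longrightarrow> c i = d i"
proof -
  from assms obtain k0 where "c k0 \<noteq> d k0" by blast
  then have "c (LEAST k. c k \<noteq> d k) \<noteq> d (LEAST k. c k \<noteq> d k)"
    by (rule LeastI[of "\<lambda>k. c k \<noteq> d k"])
  moreover have "c i = d i" if "i < (LEAST k. c k \<noteq> d k)" for i
    using not_less_Least[OF that] by simp
  ultimately show ?thesis using that by blast
qed

lemma not_lex_le_iff: "\<not> lex_le c d \<longleftrightarrow> less_fun d c"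
proof
  assume "\<not> lex_le c d"
  then have n: "c \<noteq> d" "\<not> less_fun c d" by (auto simp: lex_le_def)
  obtain k where "c k \<noteq> d k" "\<And>i. i < k \<Longrightarrow> c i = d i" using first_diff[OF n(1)] by blast
  then show "less_fun d c" using n(2) unfolding less_fun_def by (metis nat_neq_iff)
next
  assume *: "less_fun d c"
  show "\<not> lex_le c d"
    using * less_fun_asym less_fun_irrefl unfolding lex_le_def by blast
qed

lemma lex_le_less_trans: "lex_le a b \<Longrightarrow> less_fun b c \<Longrightarrow> less_fun a c"
  unfolding lex_le_def using less_fun_trans by blast

lemma less_lex_le_trans: "less_fun a b \<Longrightarrow> lex_le b c \<Longrightarrow> less_fun a c"
  unfolding lex_le_def using less_fun_trans by blast

lemma lex_le_hd: "lex_le c d \<Longrightarrow> c 0 \<le> d 0"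
proof (erule contrapos_pp)
  assume "\<not> c 0 \<le> d 0"
  then have "less_fun d c" unfolding less_fun_def by (intro exI[of _ 0]) auto
  then show "\<not> lex_le c d" by (simp add: not_lex_le_iff)
qed

lemma infinite_seq_iff: "infinite_seq c \<longleftrightarrow> (\<forall>n. c n \<noteq> 0 \<longrightarrow> (\<exists>m>n. c m \<noteq> 0))"
  unfolding infinite_seq_def finite_seq_def by (metis (no_types, lifting))

text \<open>The nonzero digit excludes the zero sequence, which also counts as infinite.\<close>

lemma infinite_seq_frequently:
  assumes "infinite_seq c" "c k \<noteq> 0"
  shows "\<exists>m\<ge>n. c m \<noteq> 0"
proof (induction n)
  case (Suc n)
  then obtain m where "m \<ge> n" "c m \<noteq> 0" by blast
  moreover from this obtain l where "l > m" "c l \<noteq> 0"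
    using assms(1) unfolding infinite_seq_iff by blast
  ultimately show ?case by (intro exI[of _ l]) auto
qed (use assms in auto)

definition splice_at :: "nat \<Rightarrow> (nat \<Rightarrow> nat) \<Rightarrow> (nat \<Rightarrow> nat) \<Rightarrow> nat \<Rightarrow> nat" where
  "splice_at n c d = (\<lambda>i. if i < n then c i else d (i - n))"

lemma shift_splice_at [simp]: "shift n (splice_at n c d) = d"
  by (auto simp: shift_def splice_at_def)

lemma splice_at_lt [simp]: "i < n \<Longrightarrow> splice_at n c d i = c i"
  by (simp add: splice_at_def)

lemma splice_at_digit [intro]:
  "c \<in> digit_seqs M \<Longrightarrow> d \<in> digit_seqs M \<Longrightarrow> splice_at n c d \<in> digit_seqs M"
  by (auto simp: splice_at_def digit_seqs_def Pi_iff)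

lemma infinite_seq_shift: "infinite_seq c \<Longrightarrow> infinite_seq (shift n c)"
proof -
  assume *: "infinite_seq c"
  show ?thesis
    unfolding infinite_seq_iff shift_def
  proof (intro allI impI)
    fix k assume "c (n + k) \<noteq> 0"
    then obtain m where "m > n + k" "c m \<noteq> 0" using * unfolding infinite_seq_iff by blast
    then show "\<exists>m>k. c (n + m) \<noteq> 0" by (intro exI[of _ "m - n"]) auto
  qed
qed

lemma infinite_seq_splice_at:
  assumes "infinite_seq d" "d k \<noteq> 0"
  shows "infinite_seq (splice_at n c d)"
  unfolding infinite_seq_iff
proof (intro allI impI)
  fix i
  obtain m where "m \<ge> Suc i" "d m \<noteq> 0" using infinite_seq_frequently[OF assms] by blast
  then show "\<exists>m>i. splice_at n c d m \<noteq> 0"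
    by (intro exI[of _ "n + m"]) (auto simp: splice_at_def)
qed

lemma digit_le: "c \<in> digit_seqs M \<Longrightarrow> c i \<le> M"
  by (auto simp: digit_seqs_def)

lemma digit_seqsI: "(\<And>i. c i \<le> M) \<Longrightarrow> c \<in> digit_seqs M"
  by (auto simp: digit_seqs_def)

lemma digit_seqs_decr: "c \<in> digit_seqs M \<Longrightarrow> c(m := c m - 1) \<in> digit_seqs M"
  by (rule digit_seqsI) (use digit_le[of c M] in \<open>auto intro: le_trans[OF diff_le_self]\<close>)

lemma shift_digit [intro]: "c \<in> digit_seqs M \<Longrightarrow> shift n c \<in> digit_seqs M"
  by (auto simp: digit_seqs_def shift_def Pi_iff)

lemma reflect_digit [simp]: "reflect M c \<in> digit_seqs M"
  by (auto simp: digit_seqs_def reflect_def)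

lemma reflect_reflect [simp]: "c \<in> digit_seqs M \<Longrightarrow> reflect M (reflect M c) = c"
  by (auto simp: digit_seqs_def reflect_def fun_eq_iff Pi_iff)

lemma reflect_shift: "reflect M (shift n c) = shift n (reflect M c)"
  by (auto simp: reflect_def shift_def)

lemma shift_shift: "shift n (shift m c) = shift (m + n) c"
  by (auto simp: shift_def add.assoc)

section \<open>Periodic approximation from below\<close>

text \<open>The properties that \<alpha> inherits when it is the final tail of a unique infinite
  expansion: being quasi-greedy yields only the weak condition \<open>upper\<close>, while
  uniqueness yields the strict condition \<open>lower\<close>.\<close>

locale admissible_seq =
  fixes M :: nat and a :: "nat \<Rightarrow> nat"
  assumes dig: "a \<in> digit_seqs M"
    and freq: "\<And>n. \<exists>m\<ge>n. a m \<noteq> 0"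
    and upper: "\<And>m. a m < M \<Longrightarrow> lex_le (shift (Suc m) a) a"
    and lower: "\<And>m. a m > 0 \<Longrightarrow> less_fun (reflect M (shift (Suc m) a)) a"
begin

lemma le_M: "a i \<le> M" using dig by (rule digit_le)

text \<open>If the first digit is below \<open>M\<close>, the two conditions confine all digits to
  the interval from \<open>M - a 0\<close> to \<open>a 0\<close>. Were
  \<open>a 0 \<le> M - a 0\<close>, the sequence would be constant and equal to its own reflected
  tail, against the strictness of \<open>lower\<close>.\<close>

lemma reflect_hd_less: "M - a 0 < a 0"
proof (cases "a 0 = M")
  case True
  obtain m where "a m \<noteq> 0" using freq by blast
  then show ?thesis using True le_M[of m] by simp
next
  case False
  then have lt: "a 0 < M" using le_M[of 0] by simp
  have ub: "a i \<le> a 0" for i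
  proof (induction i)
    case (Suc i)
    then have "lex_le (shift (Suc i) a) a" using lt by (intro upper) simp
    then show ?case using lex_le_hd by (fastforce simp: shift_def)
  qed simp
  obtain m where "a m \<noteq> 0" using freq by blast
  then have pos: "a 0 > 0" using ub[of m] by simp
  have lb: "M - a (Suc i) \<le> a 0" if "a i > 0" for i
  proof -
    have "lex_le (reflect M (shift (Suc i) a)) a" using lower[OF that] by (simp add: lex_le_def)
    then show ?thesis using lex_le_hd by (fastforce simp: shift_def reflect_def)
  qed
  have allpos: "a i > 0" for i
  proof (induction i)
    case (Suc i)
    then show ?case using lb[of i] lt by simp
  qed (use pos in simp)
  show ?thesis
  proof (rule ccontr)
    assume "\<not> M - a 0 < a 0"
    then have "M - a (Suc i) = a i" for i
      using ub[of i] ub[of "Suc i"] lb[OF allpos, of i] ub[of "i - 1"] lb[OF allpos, of "i - 1"]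
      by (cases i) auto
    then have "reflect M (shift (Suc 0) a) = a" by (auto simp: reflect_def shift_def)
    then show False using lower[OF pos] less_fun_irrefl by metis
  qed
qed

text \<open>Here \<open>j\<close> is the position that witnesses the strict inequality
  \<open>lower\<close> for the tail starting at \<open>s\<close>.\<close>

definition drops_at :: "nat \<Rightarrow> nat \<Rightarrow> bool" where
  "drops_at s j \<longleftrightarrow> M - a (s + j) < a j \<and> (\<forall>i<j. M - a (s + i) = a i)"

text \<open>A place where a period may end: digit \<open>n\<close> can be decremented, and every
  strict lower condition for a shift inside the block is already decided within the block.\<close>

definition cut_position :: "nat \<Rightarrow> bool" where
  "cut_position n \<longleftrightarrow> a n > 0 \<and>
     (\<forall>s. 0 < s \<and> s \<le> n \<and> a (s - 1) > 0 \<longrightarrow> (\<exists>j. s + j \<le> n \<and> drops_at s j))"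

lemma drops_at_exists:
  assumes "0 < s" "a (s - 1) > 0"
  shows "\<exists>j. drops_at s j"
  using lower[OF assms(2)] assms(1) by (auto simp: less_fun_def reflect_def shift_def drops_at_def)

text \<open>If \<open>n\<close> is not a cut position, the reflected tail at the least offending shift \<open>s\<close> copies
  \<open>a\<close> beyond \<open>n\<close>; the position where it finally drops below \<open>a\<close> is a cut position, because a
  shift starting strictly inside the copied block would make a tail of \<open>a\<close> exceed \<open>a\<close>.\<close>

lemma cut_position_exists: "\<exists>n\<ge>N. cut_position n"
proof -
  obtain n where n: "n \<ge> N" "a n > 0" using freq[of N] by auto
  show ?thesis
  proof (cases "cut_position n")
    case False
    define B where "B s \<longleftrightarrow> 0 < s \<and> s \<le> n \<and> a (s - 1) > 0 \<and> \<not> (\<exists>j. s + j \<le> n \<and> drops_at s j)" for s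
    from False n have ex: "\<exists>s. B s" unfolding cut_position_def B_def by blast
    define s where "s = (LEAST s. B s)"
    have Bs: "B s" unfolding s_def using ex by (rule LeastI_ex)
    have least: "\<not> B t" if "t < s" for t using that not_less_Least unfolding s_def by blast
    obtain j where j: "drops_at s j" using drops_at_exists Bs unfolding B_def by blast
    define n' where "n' = s + j"
    have n': "n < n'" using j Bs unfolding B_def n'_def by (meson not_le)
    have "cut_position n'"
      unfolding cut_position_def
    proof (intro conjI allI impI)
      show "a n' > 0" using j le_M[of j] unfolding drops_at_def n'_def by linarith
      fix t assume t: "0 < t \<and> t \<le> n' \<and> a (t - 1) > 0"
      consider "t < s" | "t = s" | "s < t" by linarith
      then show "\<exists>i. t + i \<le> n' \<and> drops_at t i"
      proof cases
        case 1
        then have "t \<le> n" using Bs unfolding B_def by simp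
        then show ?thesis using least[OF 1] t n' unfolding B_def
          by (meson le_trans less_imp_le_nat)
      next
        case 2
        then show ?thesis using j n'_def by blast
      next
        case 3
        show ?thesis
        proof (rule ccontr)
          assume no: "\<not> ?thesis"
          obtain i where i: "drops_at t i" using drops_at_exists t by blast
          then have big: "n' < t + i" using no by (meson not_le)
          define u where "u = t - s"
          have u: "0 < u" "t = s + u" "u \<le> j" using 3 t unfolding u_def n'_def by auto
          define k where "k = j - u"
          have k: "u + k = j" "k < i" "t + k = n'" using u big unfolding k_def n'_def by auto
          have "u - 1 < j" using u by simp
          then have "M - a (s + (u - 1)) = a (u - 1)" using j unfolding drops_at_def by blast
          moreover have "s + (u - 1) = t - 1" using u by simp
          ultimately have "a (u - 1) < M" using t le_M[of "t - 1"] by (metis diff_less less_le_trans)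
          then have le: "lex_le (shift u a) a" using upper[of "u - 1"] u by simp
          have eq: "a (u + l) = a l" if "l < k" for l
          proof -
            have "M - a (s + (u + l)) = a (u + l)" using j that k unfolding drops_at_def by simp
            moreover have "M - a (t + l) = a l" using i that k unfolding drops_at_def by simp
            ultimately show ?thesis using u by (simp add: add.assoc)
          qed
          have "M - a n' < a j" using j unfolding drops_at_def n'_def by simp
          moreover have "M - a n' = a k" using i k unfolding drops_at_def by metis
          ultimately have "a k < a (u + k)" using k by simp
          then have "less_fun a (shift u a)" using eq unfolding less_fun_def shift_def by metis
          then show False using le not_lex_le_iff by blast
        qed
      qed
    qed
    then show ?thesis using n n' by (meson le_trans less_imp_le_nat)
  qed (use n in blast)
qed

text \<open>The witness repeats the block of \<open>a\<close> up to a cut position \<open>n\<close>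
  with its last digit decremented. The decrement favours the upper conditions; it raises reflected
  digits, and the cut position limits the damage to equality at the end of the block.\<close>

lemma periodic_approximation:
  "\<exists>b \<in> digit_seqs M. (\<forall>i<N. b i = a i) \<and> less_fun b a \<and>
     (\<forall>m. b m < M \<longrightarrow> lex_le (shift (Suc m) b) b) \<and>
     (\<forall>m. b m > 0 \<longrightarrow> lex_le (reflect M (shift (Suc m) b)) b)"
proof -
  \<comment> \<open>Taking \<open>Suc N\<close> instead of \<open>N\<close> makes \<open>n\<close>
    positive, so the decrement does not touch the first digit of the block.\<close>
  obtain n where n: "n \<ge> Suc N" "cut_position n" using cut_position_exists by blast
  define p where "p = Suc n"
  define b where "b i = (if i mod p = n then a n - 1 else a (i mod p))" for i
  have an: "a n > 0" using n unfolding cut_position_def by simp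
  have bM: "b i \<le> M" for i using le_M[of n] le_M[of "i mod p"] unfolding b_def by auto
  have b_lt: "b i = a i" if "i < n" for i using that unfolding b_def p_def by simp
  have b_n: "b n = a n - 1" unfolding b_def p_def by simp
  have b_le: "b i \<le> a i" if "i \<le> n" for i using that b_lt b_n by (cases "i = n") auto
  have per: "b (p + i) = b i" for i unfolding b_def by simp
  have per_mod: "b (i mod p) = b i" for i unfolding b_def by simp
  have shift_mod: "shift m b = shift (m mod p) b" for m
  proof -
    have "(m mod p + i) mod p = (m + i) mod p" for i by (rule mod_add_left_eq)
    then show ?thesis unfolding shift_def b_def by metis
  qed
  have pos_case: "Suc m mod p = 0 \<or> (0 < Suc m mod p \<and> Suc m mod p \<le> n \<and> b m = b (Suc m mod p - 1)
      \<and> b m = a (Suc m mod p - 1))" for m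
  proof (cases "Suc m mod p = 0")
    case False
    then have "Suc m mod p = Suc (m mod p)" by (auto simp: mod_Suc)
    moreover have "Suc m mod p \<le> n" using mod_less_divisor[of p "Suc m"] unfolding p_def by simp
    ultimately show ?thesis using per_mod[of m] b_lt[of "m mod p"] by simp
  qed simp
  have up: "lex_le (shift (Suc m) b) b" if lt: "b m < M" for m
  proof -
    define s where "s = Suc m mod p"
    have sh: "shift (Suc m) b = shift s b" using shift_mod unfolding s_def by blast
    show ?thesis
    proof (cases "s = 0")
      case True
      then show ?thesis using sh by (simp add: lex_le_def shift_def)
    next
      case False
      then have s: "0 < s" "s \<le> n" "a (s - 1) < M" using pos_case[of m] lt unfolding s_def by auto
      have le: "lex_le (shift s a) a" using upper[OF s(3)] s by simp
      \<comment> \<open>Either the tail of \<open>a\<close> drops below \<open>a\<close> inside the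
        block, and decrementing keeps this drop, or it agrees with \<open>a\<close> up to index
        \<open>n\<close>, where the decrement itself produces the drop.\<close>
      have "less_fun (shift s b) b"
      proof (cases "\<exists>j. s + j \<le> n \<and> a (s + j) < a j \<and> (\<forall>i<j. a (s + i) = a i)")
        case True
        then obtain j where j: "s + j \<le> n" "a (s + j) < a j" "\<forall>i<j. a (s + i) = a i" by blast
        have "b (s + j) < b j" using j b_le[of "s + j"] b_lt[of j] s by simp
        moreover have "b (s + i) = b i" if "i < j" for i
          using that j b_lt[of "s + i"] b_lt[of i] s by simp
        ultimately show ?thesis unfolding less_fun_def shift_def by blast
      next
        case False
        have eq: "a (s + i) = a i" if "s + i \<le> n" for i
        proof (cases "shift s a = a")
          case True
          then show ?thesis by (metis shift_def)
        next
          case neq: False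
          then have "less_fun (shift s a) a" using le by (auto simp: lex_le_def)
          then obtain j where "a (s + j) < a j" "\<forall>i<j. a (s + i) = a i"
            unfolding less_fun_def shift_def by blast
          moreover from this have "n < s + j" using False by (meson not_le)
          ultimately show ?thesis using that by simp
        qed
        have "b (s + (n - s)) < b (n - s)" using s eq[of "n - s"] b_n an b_lt[of "n - s"] by simp
        moreover have "b (s + i) = b i" if "i < n - s" for i
          using that eq[of i] b_lt[of "s + i"] b_lt[of i] s by simp
        ultimately show ?thesis unfolding less_fun_def shift_def by blast
      qed
      then show ?thesis using sh by (simp add: lex_le_def)
    qed
  qed
  text \<open>When the reflected tail at \<open>s\<close> copies \<open>b\<close> up to the end of the period, an excess at \<open>k\<close>
    becomes an excess for the shift \<open>p - s\<close> at the smaller position \<open>k - (p - s)\<close>.\<close>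
  have no_excess: "\<not> (b k < M - b (s + k) \<and> (\<forall>i<k. b i = M - b (s + i)))"
    if "0 < s" "s \<le> n" "a (s - 1) > 0" for k s
    using that
  proof (induction k arbitrary: s rule: less_induct)
    case (less k)
    obtain j where j: "s + j \<le> n" "drops_at s j"
      using n less.prems unfolding cut_position_def by blast
    have jd: "M - a (s + j) < a j" "\<And>i. i < j \<Longrightarrow> M - a (s + i) = a i"
      using j unfolding drops_at_def by auto
    have bj: "b j = a j" using b_lt j less.prems by simp
    have eq: "b i = M - b (s + i)" if "i < j" for i
      using that jd(2)[of i] b_lt[of i] b_lt[of "s + i"] j by simp
    show ?case
    proof (rule notI, elim conjE)
      assume ex: "b k < M - b (s + k)" and ag: "\<forall>i<k. b i = M - b (s + i)"
      have kj: "\<not> k < j" using eq[of k] ex by auto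
      show False
      proof (cases "M - b (s + j) < b j")
        case True
        then show False using ex ag kj by (metis less_asym less_irrefl_nat linorder_neqE_nat)
      next
        case False
        \<comment> \<open>Only the decremented digit can spoil the strict drop. Its reflection grows
          by exactly one, so a strict inequality can become at worst an equality.\<close>
        then have sj: "s + j = n" using j jd(1) b_lt[of "s + j"] bj by (cases "s + j = n") auto
        then have e: "M - b (s + j) = b j" using False jd(1) b_n bj le_M[of n] an by simp
        then have "k > j" using kj ex by (metis less_irrefl_nat linorder_neqE_nat)
        define t where "t = Suc j"
        define l where "l = k - t"
        have t: "0 < t" "t \<le> n" "s + t = p" using sj less.prems unfolding t_def p_def by auto
        have k: "k = t + l" "l < k" using \<open>k > j\<close> unfolding l_def t_def by auto
        have "a (t - 1) > 0" using jd(1) unfolding t_def by simp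
        have idx: "b (s + (t + i)) = b i" for i using per[of i] t by (metis add.assoc)
        have "b l < M - b (t + l)" using ex k idx[of l] by simp
        moreover have "b i = M - b (t + i)" if "i < l" for i
        proof -
          have "b (t + i) = M - b (s + (t + i))" using ag that k by simp
          then show ?thesis using idx[of i] bM[of i] by simp
        qed
        ultimately show False using less.IH[OF k(2) t(1,2) \<open>a (t - 1) > 0\<close>] by blast
      qed
    qed
  qed
  have low: "lex_le (reflect M (shift (Suc m) b)) b" if gt: "b m > 0" for m
  proof -
    define s where "s = Suc m mod p"
    have sh: "shift (Suc m) b = shift s b" using shift_mod unfolding s_def by blast
    show ?thesis
    proof (cases "s = 0")
      case True
      \<comment> \<open>At a period boundary the tail is \<open>b\<close> itself, and the first
        digit decides the comparison with its reflection.\<close>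
      have "M - b 0 < b 0" using reflect_hd_less b_lt[of 0] n by simp
      then have "less_fun (reflect M (shift s b)) b"
        using True unfolding less_fun_def reflect_def shift_def by (intro exI[of _ 0]) simp
      then show ?thesis using sh by (simp add: lex_le_def)
    next
      case False
      then have s: "0 < s" "s \<le> n" "a (s - 1) > 0" using pos_case[of m] gt unfolding s_def by auto
      have "\<not> less_fun b (reflect M (shift s b))"
        using no_excess[OF s] unfolding less_fun_def reflect_def shift_def by blast
      then show ?thesis using sh not_lex_le_iff by metis
    qed
  qed
  have "less_fun b a" unfolding less_fun_def using b_lt b_n an by (intro exI[of _ n]) auto
  then show ?thesis using up low b_lt n bM by (intro bexI[of _ b] digit_seqsI) auto
qed

end

section \<open>Values of digit sequences\<close>

text \<open>The bound \<open>q_le\<close> ensures that 1 lies in the interval of representable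
  values, so that \<alpha> exists.\<close>

locale expansion_base =
  fixes M :: nat and q :: real
  assumes M_pos: "M > 0" and q_gt1: "1 < q" and q_le: "q \<le> real M + 1"
begin

definition val :: "(nat \<Rightarrow> nat) \<Rightarrow> real" where
  "val c = (\<Sum>i. real (c i) / q ^ Suc i)"

abbreviation top_val :: real where "top_val \<equiv> real M / (q - 1)"

lemma one_le_top: "1 \<le> top_val"
  using q_gt1 q_le by (simp add: field_simps)

lemma sums_const: "(\<lambda>i. real M / q ^ Suc i) sums top_val"
proof -
  have "(\<lambda>i. real M / q * (1 / q) ^ i) sums (real M / q * (1 / (1 - 1 / q)))"
    using q_gt1 by (intro sums_mult geometric_sums) simp
  moreover have "real M / q * (1 / (1 - 1 / q)) = top_val"
    using q_gt1 by (simp add: field_simps)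
  moreover have "(\<lambda>i. real M / q * (1 / q) ^ i) = (\<lambda>i. real M / q ^ Suc i)"
    by (simp add: power_divide)
  ultimately show ?thesis by metis
qed

lemma digit_summable: "c \<in> digit_seqs M \<Longrightarrow> summable (\<lambda>i. real (c i) / q ^ Suc i)"
  by (rule summable_comparison_test'[OF sums_summable[OF sums_const], of 0])
    (use q_gt1 digit_le in \<open>auto intro!: divide_right_mono\<close>)

lemma val_sums: "c \<in> digit_seqs M \<Longrightarrow> (\<lambda>i. real (c i) / q ^ Suc i) sums val c"
  unfolding val_def by (rule summable_sums[OF digit_summable])

lemma is_expansion_iff: "is_expansion M q x c \<longleftrightarrow> c \<in> digit_seqs M \<and> val c = x"
  unfolding is_expansion_def using val_sums sums_unique2 by blast

lemma val_nonneg: "c \<in> digit_seqs M \<Longrightarrow> 0 \<le> val c"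
  unfolding val_def using q_gt1 by (intro suminf_nonneg digit_summable) auto

lemma val_reflect:
  assumes "c \<in> digit_seqs M"
  shows "val (reflect M c) = top_val - val c"
proof -
  have "(\<lambda>i. real M / q ^ Suc i - real (c i) / q ^ Suc i) sums (top_val - val c)"
    by (intro sums_diff sums_const val_sums assms)
  moreover have "(\<lambda>i. real M / q ^ Suc i - real (c i) / q ^ Suc i) = (\<lambda>i. real (reflect M c i) / q ^ Suc i)"
    using digit_le[OF assms] by (auto simp: reflect_def of_nat_diff diff_divide_distrib)
  ultimately show ?thesis using val_sums[of "reflect M c"] sums_unique2 by fastforce
qed

lemma val_le_top: "c \<in> digit_seqs M \<Longrightarrow> val c \<le> top_val"
  using val_reflect[of c] val_nonneg[of "reflect M c"] by simp

lemma val_split: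
  assumes "c \<in> digit_seqs M"
  shows "val c = (\<Sum>i<n. real (c i) / q ^ Suc i) + val (shift n c) / q ^ n"
proof -
  have "val c = (\<Sum>i. real (c (i + n)) / q ^ Suc (i + n)) + (\<Sum>i<n. real (c i) / q ^ Suc i)"
    unfolding val_def by (rule suminf_split_initial_segment[OF digit_summable[OF assms]])
  also have "(\<Sum>i. real (c (i + n)) / q ^ Suc (i + n))
      = (\<Sum>i. real (shift n c i) / q ^ Suc i / q ^ n)"
    by (simp add: shift_def power_add field_simps)
  also have "\<dots> = val (shift n c) / q ^ n"
    unfolding val_def by (rule suminf_divide) (intro digit_summable shift_digit assms)
  finally show ?thesis by simp
qed

lemma val_diff:
  assumes "c \<in> digit_seqs M" "d \<in> digit_seqs M" "\<And>i. i < n \<Longrightarrow> c i = d i"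
  shows "q ^ n * (val d - val c) = val (shift n d) - val (shift n c)"
proof -
  have "(\<Sum>i<n. real (c i) / q ^ Suc i) = (\<Sum>i<n. real (d i) / q ^ Suc i)"
    using assms(3) by (intro sum.cong) auto
  then have "val d - val c = val (shift n d) / q ^ n - val (shift n c) / q ^ n"
    using val_split[OF assms(1), of n] val_split[OF assms(2), of n] by linarith
  then show ?thesis using q_gt1 by (simp add: field_simps)
qed

lemma val_shift_Suc:
  assumes "c \<in> digit_seqs M"
  shows "q * val (shift n c) = real (c n) + val (shift (Suc n) c)"
proof -
  have "val (shift n c) = real (c n) / q + val (shift (Suc n) c) / q"
    using val_split[OF shift_digit[OF assms], of n "Suc 0"]
    by (simp add: shift_shift) (simp add: shift_def)
  then show ?thesis using q_gt1 by (simp add: field_simps)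
qed

text \<open>The bookkeeping for all later comparisons at a first difference \<open>n\<close>: scaled
  by the weight of that digit, values differ by the digit difference plus the difference of the
  tails.\<close>

lemma val_diff_Suc:
  assumes "c \<in> digit_seqs M" "d \<in> digit_seqs M" "\<And>i. i < n \<Longrightarrow> c i = d i"
  shows "q ^ Suc n * (val d - val c)
    = real (d n) - real (c n) + val (shift (Suc n) d) - val (shift (Suc n) c)"
proof -
  have "q ^ Suc n * (val d - val c) = q * val (shift n d) - q * val (shift n c)"
    using val_diff[of c d n] assms by (simp flip: right_diff_distrib)
  then show ?thesis using val_shift_Suc[OF assms(1), of n] val_shift_Suc[OF assms(2), of n] by simp
qed

lemma val_splice:
  assumes "c \<in> digit_seqs M" "d \<in> digit_seqs M"
  shows "q ^ n * (val (splice_at n c d) - val c) = val d - val (shift n c)"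
  using val_diff[OF assms(1) splice_at_digit[OF assms], of n n] by simp

lemma val_zero [simp]: "val (\<lambda>i. 0) = 0"
  by (simp add: val_def)

lemma val_eq_0_iff:
  assumes "c \<in> digit_seqs M"
  shows "val c = 0 \<longleftrightarrow> (\<forall>i. c i = 0)"
  unfolding val_def using q_gt1 suminf_eq_zero_iff[OF digit_summable[OF assms]] by auto

lemma val_pos:
  assumes "c \<in> digit_seqs M" "c k \<noteq> 0"
  shows "0 < val c"
  using val_nonneg[OF assms(1)] val_eq_0_iff[OF assms(1)] assms(2) by force

lemma infinite_tail_pos:
  assumes "c \<in> digit_seqs M" "infinite_seq c" "c k \<noteq> 0"
  shows "0 < val (shift n c)"
proof -
  obtain m where "m \<ge> n" "c m \<noteq> 0" using infinite_seq_frequently[OF assms(2,3)] by blast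
  then show ?thesis by (intro val_pos[of _ "m - n"] shift_digit assms) (simp add: shift_def)
qed

section \<open>Quasi-greedy expansions\<close>

text \<open>The quasi-greedy condition in numerical form. It does not mention \<alpha>, so it can be
  used to construct \<alpha>; \<open>tails_le_alpha\<close> and \<open>lex_cond_tails_le_one\<close>
  connect it with the lexicographic condition.\<close>

definition tails_le_one :: "(nat \<Rightarrow> nat) \<Rightarrow> bool" where
  "tails_le_one c \<longleftrightarrow> (\<forall>n. c n < M \<longrightarrow> val (shift (Suc n) c) \<le> 1)"

lemma tails_le_one_shift: "tails_le_one c \<Longrightarrow> tails_le_one (shift n c)"
  unfolding tails_le_one_def shift_shift by (simp add: shift_def)

text \<open>At the first difference \<open>d\<close> gains at least one unit, while the remaining
  tail of \<open>c\<close> is worth at most one. Equality of values leaves nothing for the tail of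
  \<open>d\<close>.\<close>

lemma tails_le_one_less:
  assumes "tails_le_one c" "c \<in> digit_seqs M" "d \<in> digit_seqs M"
    "c k < d k" "\<And>i. i < k \<Longrightarrow> c i = d i"
  shows "val c \<le> val d" "val d = val c \<Longrightarrow> \<forall>i>k. d i = 0"
proof -
  have 1: "val (shift (Suc k) c) \<le> 1"
    using assms digit_le[OF assms(3), of k] unfolding tails_le_one_def by auto
  have 2: "real (d k) - real (c k) \<ge> 1" using assms(4) by linarith
  have 3: "0 \<le> val (shift (Suc k) d)" by (intro val_nonneg shift_digit assms)
  note e = val_diff_Suc[OF assms(2,3), of k, OF assms(5)]
  have "0 \<le> q ^ Suc k * (val d - val c)" using e 1 2 3 by linarith
  moreover have "0 < q ^ Suc k" using q_gt1 by simp
  ultimately show "val c \<le> val d" using zero_le_mult_iff by (metis diff_ge_0_iff_ge not_less)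
  assume "val d = val c"
  then have "val (shift (Suc k) d) = 0" using e 1 2 3 by simp
  then have z: "shift (Suc k) d i = 0" for i using val_eq_0_iff[OF shift_digit[OF assms(3)]] by blast
  show "\<forall>i>k. d i = 0"
  proof (intro allI impI)
    fix i assume "i > k"
    then show "d i = 0" using z[of "i - Suc k"] by (simp add: shift_def)
  qed
qed

lemma tails_le_one_less_infinite:
  assumes "tails_le_one c" "c \<in> digit_seqs M" "d \<in> digit_seqs M" "infinite_seq d" "less_fun c d"
  shows "val c < val d"
proof -
  obtain k where k: "c k < d k" "\<And>i. i < k \<Longrightarrow> c i = d i"
    using assms(5) unfolding less_fun_def by blast
  have "val d \<noteq> val c"
  proof
    assume "val d = val c"
    then have "\<forall>i>k. d i = 0" using tails_le_one_less(2)[OF assms(1-3) k] by blast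
    then show False using assms(4) k(1) unfolding infinite_seq_iff by (metis not_less_zero)
  qed
  then show ?thesis using tails_le_one_less(1)[OF assms(1-3) k] by simp
qed

text \<open>The quasi-greedy algorithm: \<open>r n\<close> is the value still to be represented
  after \<open>n\<close> digits. Positive remainders make the expansion infinite, and remainders at
  most 1 after a digit below \<open>M\<close> give \<open>tails_le_one\<close>.\<close>

lemma quasi_greedy_exists:
  assumes "0 \<le> x" "x \<le> top_val"
  shows "\<exists>c \<in> digit_seqs M. val c = x \<and> infinite_seq c \<and> tails_le_one c"
proof (cases "x = 0")
  case True
  have z: "(\<lambda>i. 0) \<in> digit_seqs M" by (rule digit_seqsI) simp
  show ?thesis
    by (rule bexI[OF _ z]) (auto simp: True infinite_seq_iff tails_le_one_def shift_def)
next
  case False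
  \<comment> \<open>Ceiling minus one is the largest integer strictly below \<open>q * r\<close>; a
    floor could leave remainder zero and a finite expansion.\<close>
  define dig where "dig r = min M (nat (\<lceil>q * r\<rceil> - 1))" for r :: real
  define r where "r = rec_nat x (\<lambda>_ r. q * r - real (dig r))"
  have r0: "r 0 = x" and rS: "\<And>n. r (Suc n) = q * r n - real (dig (r n))" by (auto simp: r_def)
  have step: "0 < q * t - real (dig t)" "q * t - real (dig t) \<le> top_val"
    "dig t < M \<Longrightarrow> q * t - real (dig t) \<le> 1" if t: "0 < t" "t \<le> top_val" for t
  proof -
    have "0 < q * t" using t q_gt1 by simp
    then have c1: "1 \<le> \<lceil>q * t\<rceil>" by linarith
    have lt: "real (nat (\<lceil>q * t\<rceil> - 1)) < q * t" using c1 by linarith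
    have "real (dig t) \<le> real (nat (\<lceil>q * t\<rceil> - 1))" unfolding dig_def by simp
    with lt show "0 < q * t - real (dig t)" by linarith
    show one: "q * t - real (dig t) \<le> 1" if "dig t < M"
    proof -
      have "dig t = nat (\<lceil>q * t\<rceil> - 1)" using that unfolding dig_def by simp
      then show ?thesis using c1 by linarith
    qed
    show "q * t - real (dig t) \<le> top_val"
    proof (cases "dig t < M")
      case True
      then show ?thesis using one one_le_top by linarith
    next
      case False
      then have "dig t = M" unfolding dig_def by simp
      moreover have "q * t \<le> q * top_val" using t q_gt1 by (intro mult_left_mono) auto
      \<comment> \<open>The largest value is a fixed point of the step with digit \<open>M\<close>,
        so remainders never exceed it.\<close>
      moreover have "q * top_val - real M = top_val" using q_gt1 by (simp add: field_simps)
      ultimately show ?thesis by simp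
    qed
  qed
  have r_bounds: "0 < r n \<and> r n \<le> top_val" for n
  proof (induction n)
    case 0
    then show ?case using assms False r0 by simp
  next
    case (Suc n)
    then show ?case using step rS by simp
  qed
  define c where "c n = dig (r n)" for n
  have c: "c \<in> digit_seqs M" by (rule digit_seqsI) (simp add: c_def dig_def)
  have partial: "(\<Sum>i<n. real (c i) / q ^ Suc i) = x - r n / q ^ n" for n
  proof (induction n)
    case (Suc n)
    have "r n / q ^ n = (real (c n) + r (Suc n)) / q ^ Suc n"
      using q_gt1 by (simp add: rS c_def)
    then show ?case using Suc by (simp add: add_divide_distrib)
  qed (simp add: r0)
  have "(\<lambda>n. r n / q ^ n) \<longlonglongrightarrow> 0"
  proof (rule tendsto_sandwich[of "\<lambda>_. 0" _ _ "\<lambda>n. top_val * (1 / q) ^ n"])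
    show "(\<lambda>n. top_val * (1 / q) ^ n) \<longlonglongrightarrow> 0"
      using q_gt1 by (intro tendsto_mult_right_zero LIMSEQ_power_zero) simp
    show "\<forall>\<^sub>F n in sequentially. 0 \<le> r n / q ^ n"
      using r_bounds q_gt1 by (auto intro!: always_eventually divide_nonneg_pos less_imp_le)
    show "\<forall>\<^sub>F n in sequentially. r n / q ^ n \<le> top_val * (1 / q) ^ n"
      using r_bounds q_gt1
      by (intro always_eventually allI) (simp only: power_divide power_one times_divide_eq_right
          mult_1_right, intro divide_right_mono, auto)
  qed simp
  then have "(\<lambda>n. x - r n / q ^ n) \<longlonglongrightarrow> x - 0" by (intro tendsto_intros)
  then have "(\<lambda>i. real (c i) / q ^ Suc i) sums x" unfolding sums_def partial by simp
  then have vc: "val c = x" using val_sums[OF c] sums_unique2 by blast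
  have tail: "val (shift n c) = r n" for n
    using val_split[OF c, of n] partial[of n] vc q_gt1 by simp
  have "infinite_seq c"
    unfolding infinite_seq_iff
  proof (intro allI impI)
    fix n
    have "val (shift (Suc n) c) \<noteq> 0" using tail r_bounds by (metis less_irrefl)
    then obtain i where "shift (Suc n) c i \<noteq> 0" using val_eq_0_iff[OF shift_digit[OF c]] by blast
    then show "\<exists>m>n. c m \<noteq> 0" by (intro exI[of _ "Suc n + i"]) (auto simp: shift_def)
  qed
  moreover have "tails_le_one c"
    unfolding tails_le_one_def tail rS using step(3) r_bounds by (simp add: c_def)
  ultimately show ?thesis using c vc by blast
qed

lemma lex_largest:
  assumes "c \<in> digit_seqs M" "tails_le_one c" "d \<in> digit_seqs M" "infinite_seq d" "val d = val c"
  shows "lex_le d c"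
  using tails_le_one_less_infinite[OF assms(2,1,3,4)] assms(5) not_lex_le_iff by (metis less_irrefl)

lemma quasi_greedy_eqI:
  assumes "c \<in> digit_seqs M" "val c = x" "infinite_seq c" "tails_le_one c"
  shows "quasi_greedy M x q = c"
  unfolding quasi_greedy_def
proof (rule the_equality)
  show "is_expansion M q x c \<and> infinite_seq c \<and>
    (\<forall>d. is_expansion M q x d \<and> infinite_seq d \<longrightarrow> lex_le d c)"
    using assms lex_largest unfolding is_expansion_iff by simp
  fix d assume d: "is_expansion M q x d \<and> infinite_seq d \<and>
    (\<forall>e. is_expansion M q x e \<and> infinite_seq e \<longrightarrow> lex_le e d)"
  then have "lex_le c d" using assms is_expansion_iff by blast
  moreover have "lex_le d c" using d assms lex_largest unfolding is_expansion_iff by simp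
  ultimately show "d = c" using not_lex_le_iff unfolding lex_le_def by blast
qed

section \<open>The expansion of 1 and lexicographic tail conditions\<close>

abbreviation \<alpha> :: "nat \<Rightarrow> nat" where "\<alpha> \<equiv> alpha M q"

lemma alpha_props: "\<alpha> \<in> digit_seqs M" "val \<alpha> = 1" "infinite_seq \<alpha>" "tails_le_one \<alpha>"
proof -
  obtain c where "c \<in> digit_seqs M" "val c = 1" "infinite_seq c" "tails_le_one c"
    using quasi_greedy_exists[of 1] one_le_top by auto
  moreover from this have "\<alpha> = c" unfolding alpha_def by (rule quasi_greedy_eqI)
  ultimately show "\<alpha> \<in> digit_seqs M" "val \<alpha> = 1" "infinite_seq \<alpha>" "tails_le_one \<alpha>" by auto
qed

lemma alpha_nonzero: "\<exists>k. \<alpha> k \<noteq> 0"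
  using alpha_props(1,2) val_eq_0_iff by fastforce

lemma val_lt_one_less_alpha:
  assumes "d \<in> digit_seqs M" "val d < 1"
  shows "less_fun d \<alpha>"
proof -
  have "\<not> lex_le \<alpha> d"
  proof
    assume "lex_le \<alpha> d"
    then consider "\<alpha> = d" | k where "\<alpha> k < d k" "\<And>i. i < k \<Longrightarrow> \<alpha> i = d i"
      unfolding lex_le_def less_fun_def by blast
    then show False
    proof cases
      case 1
      then show False using assms alpha_props by simp
    next
      case (2 k)
      then show False using tails_le_one_less(1)[OF alpha_props(4,1) assms(1) 2] assms alpha_props by simp
    qed
  qed
  then show ?thesis by (simp add: not_lex_le_iff)
qed

text \<open>A tail lexicographically above \<alpha> would be infinite, hence of value greater than 1
  by \<open>tails_le_one_less_infinite\<close>.\<close>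

lemma tails_le_alpha:
  assumes "c \<in> digit_seqs M" "infinite_seq c" "tails_le_one c" "c n < M"
  shows "lex_le (shift (Suc n) c) \<alpha>"
proof (rule ccontr)
  assume "\<not> ?thesis"
  then have "less_fun \<alpha> (shift (Suc n) c)" by (simp add: not_lex_le_iff)
  then have "val \<alpha> < val (shift (Suc n) c)"
    by (intro tails_le_one_less_infinite alpha_props shift_digit infinite_seq_shift assms)
  then show False using assms alpha_props unfolding tails_le_one_def by force
qed

text \<open>The excess of \<open>d\<close> over 1 is controlled by the excess of a later tail,
  divided by a power of \<open>q\<close>. The gain \<open>\<delta>\<close> is the weight of the
  positive tail of \<alpha> after the first difference; it is what later gives strict
  inequalities.\<close>

lemma less_alpha_val_bound:
  assumes "d \<in> digit_seqs M" "less_fun d \<alpha>"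
  obtains k \<delta> where "d k < M" "\<delta> > 0" "val d \<le> 1 - \<delta> + (val (shift (Suc k) d) - 1) / q ^ Suc k"
proof -
  obtain k where k: "d k < \<alpha> k" "\<And>i. i < k \<Longrightarrow> d i = \<alpha> i"
    using assms(2) unfolding less_fun_def by blast
  define \<delta> where "\<delta> = val (shift (Suc k) \<alpha>) / q ^ Suc k"
  have "0 < val (shift (Suc k) \<alpha>)" using infinite_tail_pos alpha_props alpha_nonzero by blast
  then have \<delta>: "\<delta> > 0" using q_gt1 unfolding \<delta>_def by simp
  have "q ^ Suc k * (1 - val d) = real (\<alpha> k) - real (d k) + val (shift (Suc k) \<alpha>) - val (shift (Suc k) d)"
    using val_diff_Suc[OF assms(1) alpha_props(1) k(2)] alpha_props(2) by simp
  moreover have "real (\<alpha> k) - real (d k) \<ge> 1" using k by linarith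
  ultimately have "q ^ Suc k * (1 - val d) \<ge> 1 + val (shift (Suc k) \<alpha>) - val (shift (Suc k) d)" by linarith
  then have "1 - val d \<ge> (1 + val (shift (Suc k) \<alpha>) - val (shift (Suc k) d)) / q ^ Suc k"
    using q_gt1 by (simp add: pos_divide_le_eq mult.commute)
  then have "val d \<le> 1 - \<delta> + (val (shift (Suc k) d) - 1) / q ^ Suc k"
    unfolding \<delta>_def by (simp add: add_divide_distrib diff_divide_distrib)
  moreover have "d k < M" using k digit_le[OF alpha_props(1), of k] by simp
  ultimately show ?thesis using that \<delta> by blast
qed

text \<open>Bounding a tail needs a bound for a later tail, so a direct comparison would be
  circular. Instead one starts from the trivial bound: each comparison with \<alpha> divides the
  possible excess over 1 by at least \<open>q\<close>, and the excess vanishes in the limit.\<close>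

lemma lex_cond_tails_le_one:
  assumes "c \<in> digit_seqs M" "\<And>n. c n < M \<Longrightarrow> lex_le (shift (Suc n) c) \<alpha>"
  shows "tails_le_one c"
proof -
  have bound: "val (shift (Suc n) c) \<le> 1 + top_val / q ^ j" if "c n < M" for n j
    using that
  proof (induction j arbitrary: n)
    case 0
    show ?case using val_le_top[OF shift_digit[OF assms(1)]] by (simp add: add_increasing)
  next
    case (Suc j)
    have nn: "0 \<le> top_val / q ^ Suc j" using q_gt1 by simp
    consider "shift (Suc n) c = \<alpha>" | "less_fun (shift (Suc n) c) \<alpha>"
      using assms(2)[OF Suc.prems] unfolding lex_le_def by blast
    then show ?case
    proof cases
      case 1
      then show ?thesis using alpha_props(2) nn by simp
    next
      case 2
      obtain k \<delta> where k: "shift (Suc n) c k < M" "\<delta> > 0"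
        "val (shift (Suc n) c) \<le> 1 - \<delta> + (val (shift (Suc k) (shift (Suc n) c)) - 1) / q ^ Suc k"
        using less_alpha_val_bound[OF shift_digit[OF assms(1)] 2] by blast
      define t where "t = val (shift (Suc (Suc n + k)) c)"
      have t: "t \<le> 1 + top_val / q ^ j" unfolding t_def using Suc.IH[of "Suc n + k"] k(1) by (simp add: shift_def)
      have "val (shift (Suc k) (shift (Suc n) c)) = t" unfolding t_def shift_shift by simp
      moreover have "(t - 1) / q ^ Suc k \<le> top_val / q ^ Suc j"
      proof -
        have "(t - 1) / q ^ Suc k \<le> (top_val / q ^ j) / q ^ Suc k"
          using t q_gt1 by (intro divide_right_mono) auto
        also have "\<dots> \<le> (top_val / q ^ j) / q"
          using q_gt1 self_le_power[of q "Suc k"] by (intro divide_left_mono) auto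
        finally show ?thesis by (simp add: mult.commute mult.left_commute)
      qed
      ultimately show ?thesis using k by simp
    qed
  qed
  show ?thesis
    unfolding tails_le_one_def
  proof (intro allI impI)
    fix n assume n: "c n < M"
    have "(\<lambda>j. 1 + top_val * (1 / q) ^ j) \<longlonglongrightarrow> 1 + 0"
      using q_gt1 by (intro tendsto_add tendsto_const tendsto_mult_right_zero LIMSEQ_power_zero) simp
    moreover have "val (shift (Suc n) c) \<le> 1 + top_val * (1 / q) ^ j" for j
      using bound[OF n, of j] by (simp add: power_divide)
    ultimately show "val (shift (Suc n) c) \<le> 1"
      using LIMSEQ_le_const[of _ "1 + 0"] by fastforce
  qed
qed

lemma strict_lex_cond_tails_lt_one:
  assumes "c \<in> digit_seqs M" "\<And>n. c n < M \<Longrightarrow> less_fun (shift (Suc n) c) \<alpha>" "c n < M"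
  shows "val (shift (Suc n) c) < 1"
proof -
  have Q: "tails_le_one c" using assms by (intro lex_cond_tails_le_one) (auto simp: lex_le_def)
  obtain k \<delta> where k: "shift (Suc n) c k < M" "\<delta> > 0"
    "val (shift (Suc n) c) \<le> 1 - \<delta> + (val (shift (Suc k) (shift (Suc n) c)) - 1) / q ^ Suc k"
    using less_alpha_val_bound[OF shift_digit[OF assms(1)] assms(2)[OF assms(3)]] by blast
  have "val (shift (Suc k) (shift (Suc n) c)) \<le> 1"
    using tails_le_one_shift[OF Q] k(1) unfolding tails_le_one_def by blast
  then have "(val (shift (Suc k) (shift (Suc n) c)) - 1) / q ^ Suc k \<le> 0"
    using q_gt1 by (intro divide_nonpos_pos) auto
  then show ?thesis using k by linarith
qed

section \<open>Reflection and uniqueness\<close>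

text \<open>At the first difference \<open>e\<close> is either larger, which forces \<open>e\<close>
  to be finite, or smaller, which forces its reflection to be finite.\<close>

lemma not_doubly_infinite_if_ne:
  assumes "c \<in> digit_seqs M" "tails_le_one c" "tails_le_one (reflect M c)"
    "e \<in> digit_seqs M" "val e = val c" "e \<noteq> c"
  shows "\<not> doubly_infinite_seq M e"
proof -
  obtain k where k: "c k \<noteq> e k" "\<And>i. i < k \<Longrightarrow> c i = e i" using first_diff assms(6) by metis
  show ?thesis
  proof (cases "c k < e k")
    case True
    then have "less_fun c e" using k unfolding less_fun_def by blast
    then show ?thesis
      using tails_le_one_less_infinite[OF assms(2,1,4)] assms(5) unfolding doubly_infinite_seq_def by auto
  next
    case False
    then have "reflect M c k < reflect M e k"
      using k digit_le[OF assms(1), of k] by (simp add: reflect_def)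
    then have "less_fun (reflect M c) (reflect M e)"
      using k unfolding less_fun_def by (metis reflect_def)
    then show ?thesis
      using tails_le_one_less_infinite[OF assms(3) reflect_digit reflect_digit, of e] assms(5)
        val_reflect[OF assms(1)] val_reflect[OF assms(4)]
      unfolding doubly_infinite_seq_def by auto
  qed
qed

lemma tails_lt_one_less:
  assumes "c \<in> digit_seqs M" "e \<in> digit_seqs M" "\<And>n. c n < M \<Longrightarrow> val (shift (Suc n) c) < 1"
    "less_fun c e"
  shows "val c < val e"
proof -
  obtain k where k: "c k < e k" "\<And>i. i < k \<Longrightarrow> c i = e i"
    using assms(4) unfolding less_fun_def by blast
  have 1: "val (shift (Suc k) c) < 1" using k digit_le[OF assms(2), of k] by (intro assms(3)) simp
  have 2: "real (e k) - real (c k) \<ge> 1" using k by linarith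
  have 3: "0 \<le> val (shift (Suc k) e)" by (intro val_nonneg shift_digit assms)
  have "0 < q ^ Suc k * (val e - val c)"
    using val_diff_Suc[OF assms(1,2), of k, OF k(2)] 1 2 3 by linarith
  moreover have "0 < q ^ Suc k" using q_gt1 by simp
  ultimately show ?thesis using zero_less_mult_pos by fastforce
qed

text \<open>Strict conditions make all relevant tails, and reflected tails, worth less than 1, so
  any other sequence, above or below \<open>c\<close>, has a different value.\<close>

lemma U_setI:
  assumes "c \<in> digit_seqs M" "\<And>n. c n < M \<Longrightarrow> less_fun (shift (Suc n) c) \<alpha>"
    "\<And>n. c n > 0 \<Longrightarrow> less_fun (reflect M (shift (Suc n) c)) \<alpha>"
  shows "val c \<in> U_set M q"
proof -
  have up: "val (shift (Suc n) c) < 1" if "c n < M" for n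
    using strict_lex_cond_tails_lt_one assms(1,2) that by blast
  have "less_fun (shift (Suc n) (reflect M c)) \<alpha>" if "reflect M c n < M" for n
  proof -
    have "c n > 0" using that by (auto simp: reflect_def intro: gr0I)
    then show ?thesis using assms(3) by (simp add: reflect_shift)
  qed
  then have low: "val (shift (Suc n) (reflect M c)) < 1" if "reflect M c n < M" for n
    using strict_lex_cond_tails_lt_one[OF reflect_digit] that by blast
  have "e = c" if e: "e \<in> digit_seqs M" "val e = val c" for e
  proof (rule ccontr)
    assume "e \<noteq> c"
    then obtain k where k: "c k \<noteq> e k" "\<And>i. i < k \<Longrightarrow> c i = e i" using first_diff by metis
    show False
    proof (cases "c k < e k")
      case True
      then have "less_fun c e" using k unfolding less_fun_def by blast
      then show False using tails_lt_one_less[OF assms(1) e(1) up] e by simp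
    next
      case False
      then have "reflect M c k < reflect M e k"
        using k digit_le[OF assms(1), of k] by (simp add: reflect_def)
      then have "less_fun (reflect M c) (reflect M e)"
        using k unfolding less_fun_def by (metis reflect_def)
      then show False
        using tails_lt_one_less[OF reflect_digit reflect_digit low, of e] e
          val_reflect[OF assms(1)] val_reflect[OF e(1)] by simp
    qed
  qed
  then show ?thesis
    using assms(1) val_nonneg val_le_top unfolding U_set_def J_set_def is_expansion_iff by auto
qed

lemma U_set_reflect:
  assumes "y \<in> U_set M q"
  shows "top_val - y \<in> U_set M q"
proof -
  obtain c where c: "c \<in> digit_seqs M" "val c = y"
    and un: "\<And>e. e \<in> digit_seqs M \<Longrightarrow> val e = y \<Longrightarrow> e = c"
    using assms unfolding U_set_def is_expansion_iff by blast
  have "\<exists>!e. is_expansion M q (top_val - y) e"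
  proof (rule ex1I[of _ "reflect M c"])
    show "is_expansion M q (top_val - y) (reflect M c)"
      using c val_reflect unfolding is_expansion_iff by simp
    fix e assume "is_expansion M q (top_val - y) e"
    then have e: "e \<in> digit_seqs M" "val e = top_val - y" unfolding is_expansion_iff by auto
    then have "reflect M e = c" using val_reflect[OF e(1)] by (intro un) auto
    then show "e = reflect M c" using e by auto
  qed
  then show ?thesis using assms unfolding U_set_def J_set_def by simp
qed

text \<open>The forward direction is \<open>not_doubly_infinite_if_ne\<close>. Conversely, for
  \<open>q < M + 1\<close> the quasi-greedy expansion of \<open>x\<close> and the reflected one of
  \<open>top_val - x\<close> are both doubly infinite, hence equal, and each supplies one of the two
  conditions.\<close>

lemma V_set_iff:
  assumes "0 \<le> x" "x \<le> top_val"
  shows "x \<in> V_set M q \<longleftrightarrow> (\<exists>\<^sub>\<le>\<^sub>1c. is_expansion M q x c \<and> doubly_infinite_seq M c)"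
proof
  assume "x \<in> V_set M q"
  then obtain c where c: "c \<in> V_seqs M q" "x = val c" unfolding V_set_def val_def by blast
  have cd: "c \<in> digit_seqs M" using c unfolding V_seqs_def by simp
  have 1: "tails_le_one c" using c unfolding V_seqs_def by (intro lex_cond_tails_le_one) auto
  have 2: "tails_le_one (reflect M c)"
  proof (rule lex_cond_tails_le_one[OF reflect_digit])
    fix n assume "reflect M c n < M"
    then have "c n > 0" by (auto simp: reflect_def intro: gr0I)
    then show "lex_le (shift (Suc n) (reflect M c)) \<alpha>"
      using c unfolding V_seqs_def by (simp add: reflect_shift)
  qed
  show "\<exists>\<^sub>\<le>\<^sub>1c. is_expansion M q x c \<and> doubly_infinite_seq M c"
    unfolding Uniq_def is_expansion_iff using not_doubly_infinite_if_ne[OF cd 1 2] c(2) by metis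
next
  assume un: "\<exists>\<^sub>\<le>\<^sub>1c. is_expansion M q x c \<and> doubly_infinite_seq M c"
  obtain c where c: "c \<in> digit_seqs M" "val c = x" "infinite_seq c" "tails_le_one c"
    using quasi_greedy_exists[OF assms] by blast
  have "lex_le (reflect M (shift (Suc n) c)) \<alpha>" if n: "c n > 0" for n
  proof (cases "q = real M + 1")
    case True
    \<comment> \<open>In this base a tail of digits \<open>M\<close> is worth exactly 1, so a
      quasi-greedy expansion need not be doubly infinite. But \<alpha> is then the largest sequence,
      and the lower condition is automatic.\<close>
    have K: "(\<lambda>_. M) \<in> digit_seqs M" by (rule digit_seqsI) simp
    have "val (\<lambda>_. M) = 1" using val_sums[OF K] sums_const sums_unique2 True M_pos by fastforce
    then have \<alpha>: "\<alpha> = (\<lambda>_. M)"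
      unfolding alpha_def using M_pos
      by (intro quasi_greedy_eqI K) (auto simp: infinite_seq_iff tails_le_one_def)
    show ?thesis
    proof (rule ccontr)
      assume "\<not> ?thesis"
      then show False unfolding not_lex_le_iff \<alpha> less_fun_def reflect_def by auto
    qed
  next
    case False
    then have top: "1 < top_val" using q_gt1 q_le by (simp add: field_simps)
    \<comment> \<open>If the reflection were finite, \<open>d\<close> would end in digits
      \<open>M\<close> after a smaller digit, and that tail would be worth \<open>top_val\<close>,
      which exceeds 1.\<close>
    have dbl: "doubly_infinite_seq M d"
      if d: "d \<in> digit_seqs M" "infinite_seq d" "tails_le_one d" for d
    proof -
      have "infinite_seq (reflect M d)"
      proof (rule ccontr)
        assume "\<not> ?thesis"
        then obtain k where k: "reflect M d k \<noteq> 0" "\<forall>m>k. reflect M d m = 0"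
          unfolding infinite_seq_def finite_seq_def by blast
        have "val (shift (Suc k) (reflect M d)) = 0"
          using k(2) by (simp add: shift_def)
        then have "val (shift (Suc k) d) = top_val"
          using val_reflect[OF shift_digit[OF d(1)]] by (simp add: reflect_shift)
        moreover have "d k < M" using k(1) by (simp add: reflect_def)
        ultimately show False using d(3) top unfolding tails_le_one_def by force
      qed
      then show ?thesis using d unfolding doubly_infinite_seq_def by simp
    qed
    obtain d where d: "d \<in> digit_seqs M" "val d = top_val - x" "infinite_seq d" "tails_le_one d"
      using quasi_greedy_exists[of "top_val - x"] assms by auto
    have "doubly_infinite_seq M (reflect M d)"
      using dbl[OF d(1,3,4)] d(1) unfolding doubly_infinite_seq_def by simp
    moreover have "is_expansion M q x (reflect M d)"
      using val_reflect[OF d(1)] d(2) unfolding is_expansion_iff by simp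
    moreover have "is_expansion M q x c \<and> doubly_infinite_seq M c"
      using dbl c unfolding is_expansion_iff by blast
    ultimately have "c = reflect M d" using un unfolding Uniq_def by blast
    then have "d = reflect M c" using d(1) by simp
    moreover from this have "d n < M" using n M_pos by (simp add: reflect_def)
    ultimately show ?thesis using tails_le_alpha[OF d(1,3,4), of n] by (simp add: reflect_shift)
  qed
  then have "c \<in> V_seqs M q" using c tails_le_alpha unfolding V_seqs_def by blast
  then show "x \<in> V_set M q" using c unfolding V_set_def val_def by blast
qed

section \<open>The closure of the univoque set\<close>

lemma left_gap_if_two_infinite_expansions:
  assumes "c \<in> digit_seqs M" "d \<in> digit_seqs M" "val c = x" "val d = x"
    "infinite_seq c" "infinite_seq d" "c \<noteq> d"
  obtains \<epsilon> where "\<epsilon> > 0" "\<And>y. x - \<epsilon> < y \<Longrightarrow> y < x \<Longrightarrow> y \<notin> U_set M q"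
proof -
  obtain k where k: "c k \<noteq> d k" "\<And>i. i < k \<Longrightarrow> c i = d i" using first_diff assms(7) by blast
  \<comment> \<open>Two distinct expansions exclude 0, so both sequences are nonzero and, being
    infinite, have positive tails.\<close>
  have "x \<noteq> 0"
    using assms(3,4,7) val_eq_0_iff[OF assms(1)] val_eq_0_iff[OF assms(2)] by fastforce
  then have nz: "\<exists>i. c i \<noteq> 0" "\<exists>i. d i \<noteq> 0"
    using assms(3,4) val_eq_0_iff[OF assms(1)] val_eq_0_iff[OF assms(2)] by auto
  have tp: "0 < val (shift (Suc k) c)" "0 < val (shift (Suc k) d)"
    using infinite_tail_pos nz assms by blast+
  have Q: "0 < q ^ Suc k" using q_gt1 by simp
  \<comment> \<open>The smaller contribution after position \<open>k\<close>: either tail can absorb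
    a decrease below this amount while digit \<open>k\<close> stays fixed, so the two new expansions
    still differ there.\<close>
  define \<epsilon> where "\<epsilon> = min (val (shift (Suc k) c)) (val (shift (Suc k) d)) / q ^ Suc k"
  have lower_tail: "\<exists>f. is_expansion M q y f \<and> f k = e k"
    if e: "e \<in> digit_seqs M" "val e = x" "\<epsilon> \<le> val (shift (Suc k) e) / q ^ Suc k"
      and y: "x - \<epsilon> < y" "y < x" for e y
  proof -
    define t where "t = val (shift (Suc k) e) - q ^ Suc k * (x - y)"
    have "x - y < val (shift (Suc k) e) / q ^ Suc k" using e y by linarith
    then have "0 \<le> t" using Q unfolding t_def by (simp add: pos_less_divide_eq mult.commute)
    moreover have "0 < q ^ Suc k * (x - y)" using Q y by (intro mult_pos_pos) auto
    then have "t \<le> top_val"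
      using val_le_top[OF shift_digit[OF e(1)], of "Suc k"] unfolding t_def by linarith
    ultimately obtain g where g: "g \<in> digit_seqs M" "val g = t" using quasi_greedy_exists by blast
    define f where "f = splice_at (Suc k) e g"
    have "q ^ Suc k * (val f - x) = q ^ Suc k * (y - x)"
      using val_splice[OF e(1) g(1), of "Suc k"] g e unfolding f_def t_def
      by (simp only:) (simp add: algebra_simps)
    then have "val f = y" using q_gt1 by simp
    then show ?thesis using e g unfolding is_expansion_iff f_def by (intro exI[of _ f]) (auto simp: f_def)
  qed
  show ?thesis
  proof (rule that)
    show "\<epsilon> > 0" unfolding \<epsilon>_def using tp Q by (intro divide_pos_pos) auto
    fix y assume y: "x - \<epsilon> < y" "y < x"
    have "\<epsilon> \<le> val (shift (Suc k) c) / q ^ Suc k" "\<epsilon> \<le> val (shift (Suc k) d) / q ^ Suc k"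
      unfolding \<epsilon>_def using Q by (auto intro!: divide_right_mono)
    then obtain f g where "is_expansion M q y f" "f k = c k" "is_expansion M q y g" "g k = d k"
      using lower_tail[of c y] lower_tail[of d y] assms y by blast
    then show "y \<notin> U_set M q" using k(1) unfolding U_set_def by fastforce
  qed
qed

lemma left_gap_if_not_unique:
  assumes "0 \<le> x" "x \<le> top_val" "\<not> (\<exists>!c. is_expansion M q x c \<and> infinite_seq c)"
  obtains \<epsilon> where "\<epsilon> > 0" "\<And>y. x - \<epsilon> < y \<Longrightarrow> y < x \<Longrightarrow> y \<notin> U_set M q"
proof -
  obtain c where c: "c \<in> digit_seqs M" "val c = x" "infinite_seq c"
    using quasi_greedy_exists[OF assms(1,2)] by blast
  then obtain d where "d \<in> digit_seqs M" "val d = x" "infinite_seq d" "c \<noteq> d"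
    using assms(3) unfolding is_expansion_iff by blast
  then show ?thesis using left_gap_if_two_infinite_expansions c that by metis
qed

text \<open>If both uniqueness claims fail, there is a gap to the left of \<open>x\<close> and, by
  reflection, one to its right. Moreover \<open>x\<close> is not univoque, since an infinite
  expansion exists and would then be the only one.\<close>

lemma closure_U_set_imp:
  assumes "0 \<le> x" "x \<le> top_val" "x \<in> closure (U_set M q)"
  shows "(\<exists>!c. is_expansion M q x c \<and> infinite_seq c) \<or>
       (\<exists>!c. is_expansion M q (top_val - x) c \<and> infinite_seq c)"
proof (rule ccontr)
  assume "\<not> ?thesis"
  then have n1: "\<not> (\<exists>!c. is_expansion M q x c \<and> infinite_seq c)"
    and n2: "\<not> (\<exists>!c. is_expansion M q (top_val - x) c \<and> infinite_seq c)" by blast+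
  obtain \<epsilon>1 where e1: "\<epsilon>1 > 0" "\<And>y. x - \<epsilon>1 < y \<Longrightarrow> y < x \<Longrightarrow> y \<notin> U_set M q"
    using left_gap_if_not_unique[OF assms(1,2) n1] by blast
  obtain \<epsilon>2 where e2: "\<epsilon>2 > 0"
      "\<And>y. top_val - x - \<epsilon>2 < y \<Longrightarrow> y < top_val - x \<Longrightarrow> y \<notin> U_set M q"
    using left_gap_if_not_unique[OF _ _ n2] assms by auto
  have "x \<notin> U_set M q"
  proof
    assume "x \<in> U_set M q"
    then have un: "\<exists>!c. is_expansion M q x c" unfolding U_set_def by blast
    obtain c where "is_expansion M q x c" "infinite_seq c"
      using quasi_greedy_exists[OF assms(1,2)] unfolding is_expansion_iff by blast
    then show False using un n1 by blast
  qed
  obtain y where y: "y \<in> U_set M q" "dist y x < min \<epsilon>1 \<epsilon>2"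
    using assms(3) e1(1) e2(1) unfolding closure_approachable by (metis min_less_iff_conj)
  consider "y = x" | "y < x" | "y > x" by linarith
  then show False
  proof cases
    case 1
    then show False using y \<open>x \<notin> U_set M q\<close> by simp
  next
    case 2
    then show False using y e1(2)[of y] by (simp add: dist_real_def)
  next
    case 3
    then show False using U_set_reflect[OF y(1)] y(2) e2(2)[of "top_val - y"]
      by (simp add: dist_real_def)
  qed
qed

text \<open>If the reflected tail were worth at least 1, there would be room to add 1 to the tail:
  one unit of digit \<open>m\<close> could be traded for it, giving a second infinite
  expansion.\<close>

lemma unique_infinite_reflected_tail:
  assumes "c \<in> digit_seqs M" "infinite_seq c"
    and un: "\<And>e. e \<in> digit_seqs M \<Longrightarrow> infinite_seq e \<Longrightarrow> val e = val c \<Longrightarrow> e = c"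
    and "c m > 0"
  shows "less_fun (reflect M (shift (Suc m) c)) \<alpha>"
proof (rule val_lt_one_less_alpha[OF reflect_digit], rule ccontr)
  assume "\<not> val (reflect M (shift (Suc m) c)) < 1"
  then have t: "val (shift (Suc m) c) + 1 \<le> top_val"
    using val_reflect[OF shift_digit[OF assms(1)], of "Suc m"] by linarith
  have t0: "0 \<le> val (shift (Suc m) c)" by (intro val_nonneg shift_digit assms)
  obtain g where g: "g \<in> digit_seqs M" "val g = val (shift (Suc m) c) + 1" "infinite_seq g"
    using quasi_greedy_exists[of "val (shift (Suc m) c) + 1"] t t0 by auto
  then have "\<exists>i. g i \<noteq> 0" using val_eq_0_iff[OF g(1)] t0 by fastforce
  define e where "e = splice_at (Suc m) (c(m := c m - 1)) g"
  have e_dig: "e \<in> digit_seqs M"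
    unfolding e_def by (intro splice_at_digit digit_seqs_decr assms g)
  have e_inf: "infinite_seq e"
    unfolding e_def using \<open>\<exists>i. g i \<noteq> 0\<close> infinite_seq_splice_at g by blast
  have em: "e m = c m - 1" and ei: "\<And>i. i < m \<Longrightarrow> c i = e i" unfolding e_def by auto
  have "q ^ Suc m * (val e - val c) = 0"
    using val_diff_Suc[OF assms(1) e_dig ei] g(2) em assms(4)
    unfolding e_def by (simp add: of_nat_diff)
  then have "val e = val c" using q_gt1 by simp
  then have "e = c" using un e_dig e_inf by blast
  then show False using em assms(4) by simp
qed

text \<open>A strict lexicographic inequality is decided by finitely many digits.\<close>

lemma eventually_prefix_less:
  assumes "less_fun (reflect M (shift s c)) a"
  shows "\<forall>\<^sub>F N in sequentially. \<forall>d. (\<forall>i<N. d i = c i) \<longrightarrow> less_fun (reflect M (shift s d)) a"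
proof -
  obtain k where k: "M - c (s + k) < a k" "\<And>i. i < k \<Longrightarrow> M - c (s + i) = a i"
    using assms unfolding less_fun_def reflect_def shift_def by blast
  have "less_fun (reflect M (shift s d)) a" if "N \<ge> Suc (s + k)" "\<forall>i<N. d i = c i" for N d
    unfolding less_fun_def reflect_def shift_def using k that by (intro exI[of _ k]) auto
  then show ?thesis unfolding eventually_sequentially by blast
qed

lemma val_dist_le:
  assumes "c \<in> digit_seqs M" "d \<in> digit_seqs M" "\<And>i. i < N \<Longrightarrow> d i = c i"
  shows "dist (val d) (val c) \<le> top_val / q ^ N"
proof -
  have "q ^ N * (val d - val c) = val (shift N d) - val (shift N c)"
    by (intro val_diff assms) (simp add: assms)
  then have "\<bar>q ^ N * (val d - val c)\<bar> \<le> top_val"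
    using val_nonneg[OF shift_digit[OF assms(1)], of N] val_le_top[OF shift_digit[OF assms(1)], of N]
      val_nonneg[OF shift_digit[OF assms(2)], of N] val_le_top[OF shift_digit[OF assms(2)], of N]
    by linarith
  then show ?thesis using q_gt1 by (simp add: dist_real_def abs_mult pos_le_divide_eq mult.commute)
qed

lemma unique_infinite_imp_closure:
  assumes "\<exists>!c. is_expansion M q x c \<and> infinite_seq c"
  shows "x \<in> closure (U_set M q)"
proof (cases "x \<in> U_set M q")
  case True
  then show ?thesis using closure_subset by blast
next
  case False
  obtain c where c: "c \<in> digit_seqs M" "val c = x" "infinite_seq c"
    and un: "\<And>e. e \<in> digit_seqs M \<Longrightarrow> infinite_seq e \<Longrightarrow> val e = x \<Longrightarrow> e = c"
    using assms unfolding is_expansion_iff by blast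
  have xJ: "0 \<le> x" "x \<le> top_val" using c val_nonneg val_le_top by auto
  \<comment> \<open>Some infinite expansion of \<open>x\<close> is quasi-greedy, so the only one
    is.\<close>
  have cQ: "tails_le_one c" using quasi_greedy_exists[OF xJ] un by blast
  obtain b where b: "b \<in> digit_seqs M" "val b = x" "b \<noteq> c"
    using False xJ c unfolding U_set_def J_set_def is_expansion_iff by auto
  then have "finite_seq b" using un unfolding infinite_seq_def by blast
  then obtain l where l: "b l \<noteq> 0" "\<forall>m>l. b m = 0" unfolding finite_seq_def by blast
  text \<open>Trading the last unit of the finite expansion \<open>b\<close> for \<open>\<alpha>\<close> shows that \<open>c\<close> ends in \<open>\<alpha>\<close>.\<close>
  define e where "e = splice_at (Suc l) (b(l := b l - 1)) \<alpha>"
  have e_dig: "e \<in> digit_seqs M"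
    unfolding e_def by (intro splice_at_digit digit_seqs_decr b alpha_props)
  have el: "e l = b l - 1" and ei: "\<And>i. i < l \<Longrightarrow> b i = e i" unfolding e_def by auto
  have "val (shift (Suc l) b) = 0"
    using l(2) by (simp add: shift_def)
  then have "q ^ Suc l * (val e - val b) = 0"
    using val_diff_Suc[OF b(1) e_dig ei] alpha_props(2) el l(1)
    unfolding e_def by (simp add: of_nat_diff)
  then have "val e = x" using q_gt1 b by simp
  moreover have "infinite_seq e"
    unfolding e_def using alpha_nonzero infinite_seq_splice_at alpha_props(3) by blast
  ultimately have "e = c" using un e_dig by blast
  define L where "L = Suc l"
  have cL: "shift L c = \<alpha>" and cl: "c l < M"
    using \<open>e = c\<close> el l(1) digit_le[OF b(1), of l] unfolding e_def L_def by auto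
  have c\<alpha>: "c (L + i) = \<alpha> i" for i using cL by (metis shift_def)
  have up: "lex_le (shift (Suc m) c) \<alpha>" if "c m < M" for m
    using tails_le_alpha[OF c(1,3) cQ that] .
  have low: "less_fun (reflect M (shift (Suc m) c)) \<alpha>" if "c m > 0" for m
    using unique_infinite_reflected_tail[OF c(1,3) _ that] un c(2) by blast
  have shL: "shift (Suc (L + m)) c = shift (Suc m) \<alpha>" for m
    unfolding cL[symmetric] shift_shift by simp
  interpret admissible_seq M \<alpha>
  proof
    show "\<alpha> \<in> digit_seqs M" by (rule alpha_props)
    show "\<exists>m\<ge>n. \<alpha> m \<noteq> 0" for n
      using infinite_seq_frequently alpha_props(3) alpha_nonzero by blast
    show "lex_le (shift (Suc m) \<alpha>) \<alpha>" if "\<alpha> m < M" for m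
      using up[of "L + m"] that shL c\<alpha> by simp
    show "less_fun (reflect M (shift (Suc m) \<alpha>)) \<alpha>" if "\<alpha> m > 0" for m
      using low[of "L + m"] that shL c\<alpha> by simp
  qed
  \<comment> \<open>Only the finitely many lower conditions before \<open>L\<close> must survive by
    agreement of prefixes; from \<open>L\<close> on, the approximating sequence brings its own
    conditions.\<close>
  have ev: "\<forall>\<^sub>F N in sequentially. \<forall>m\<in>{..<L}. c m > 0 \<longrightarrow>
      (\<forall>d. (\<forall>i<N. d i = c i) \<longrightarrow> less_fun (reflect M (shift (Suc m) d)) \<alpha>)"
    by (rule eventually_ball_finite) (use eventually_prefix_less[OF low] in \<open>auto intro: eventually_mono\<close>)
  have lim: "(\<lambda>N. top_val * (1 / q) ^ N) \<longlonglongrightarrow> 0"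
    using q_gt1 by (intro tendsto_mult_right_zero LIMSEQ_power_zero) simp
  show ?thesis
    unfolding closure_approachable
  proof (intro allI impI)
    fix \<epsilon> :: real assume "\<epsilon> > 0"
    then have "\<forall>\<^sub>F N in sequentially. top_val * (1 / q) ^ N < \<epsilon>"
      using order_tendstoD(2)[OF lim] by blast
    from eventually_happens'[OF sequentially_bot eventually_conj[OF this ev]]
    obtain N where small: "top_val * (1 / q) ^ N < \<epsilon>" and
      N: "\<And>m d. m < L \<Longrightarrow> c m > 0 \<Longrightarrow> (\<forall>i<N. d i = c i) \<Longrightarrow> less_fun (reflect M (shift (Suc m) d)) \<alpha>"
      by auto
    obtain \<beta> where \<beta>: "\<beta> \<in> digit_seqs M" "\<forall>i<N. \<beta> i = \<alpha> i" "less_fun \<beta> \<alpha>"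
      and bu: "\<And>m. \<beta> m < M \<Longrightarrow> lex_le (shift (Suc m) \<beta>) \<beta>"
      and bl: "\<And>m. \<beta> m > 0 \<Longrightarrow> lex_le (reflect M (shift (Suc m) \<beta>)) \<beta>"
      using periodic_approximation[of N] by blast
    define d where "d = splice_at L c \<beta>"
    have d: "d \<in> digit_seqs M" unfolding d_def using c \<beta> by blast
    have d_lt: "d i = c i" if "i < L" for i using that unfolding d_def by simp
    have d_ge: "d (L + i) = \<beta> i" for i unfolding d_def splice_at_def by simp
    have dsh: "shift (Suc (L + m)) d = shift (Suc m) \<beta>" for m
      using d_ge unfolding shift_def by (metis add.assoc add_Suc_right add_Suc)
    have agree: "d i = c i" if "i < N" for i
      using that \<beta>(2) c\<alpha>[of "i - L"] d_lt[of i] d_ge[of "i - L"] by (cases "i < L") auto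
    \<comment> \<open>Replacing the final \<alpha> by a smaller sequence lowers every earlier tail,
      which turns the weak upper conditions of \<open>c\<close> into strict ones for
      \<open>d\<close>.\<close>
    have less_dc: "less_fun (shift (Suc m) d) (shift (Suc m) c)" if "m < L" for m
    proof -
      obtain k where k: "\<beta> k < \<alpha> k" "\<And>i. i < k \<Longrightarrow> \<beta> i = \<alpha> i"
        using \<beta>(3) unfolding less_fun_def by blast
      have eq: "d i = c i" if "i < L + k" for i
        using that k(2) c\<alpha>[of "i - L"] d_lt[of i] d_ge[of "i - L"] by (cases "i < L") auto
      show ?thesis
        unfolding less_fun_def shift_def
        using that eq k(1) d_ge[of k] c\<alpha>[of k] by (intro exI[of _ "L + k - Suc m"]) auto
    qed
    have "val d \<in> U_set M q"
    proof (rule U_setI[OF d])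
      fix m assume m: "d m < M"
      show "less_fun (shift (Suc m) d) \<alpha>"
      proof (cases "m < L")
        case True
        then show ?thesis using less_dc up m d_lt less_lex_le_trans by metis
      next
        case False
        then obtain i where i: "m = L + i" using le_Suc_ex not_less by blast
        \<comment> \<open>Weak comparison with \<beta> suffices because \<beta> itself is below
          \<alpha>.\<close>
        then show ?thesis using bu[of i] m d_ge dsh \<beta>(3) lex_le_less_trans by metis
      qed
    next
      fix m assume m: "d m > 0"
      show "less_fun (reflect M (shift (Suc m) d)) \<alpha>"
      proof (cases "m < L")
        case True
        then show ?thesis using N m d_lt agree by metis
      next
        case False
        then obtain i where i: "m = L + i" using le_Suc_ex not_less by blast
        then show ?thesis using bl[of i] m d_ge dsh \<beta>(3) lex_le_less_trans by metis
      qed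
    qed
    moreover have "dist (val d) x < \<epsilon>"
      using val_dist_le[OF c(1) d, of N, OF agree] small c(2) by (simp add: power_divide)
    ultimately show "\<exists>y\<in>U_set M q. dist y x < \<epsilon>" by blast
  qed
qed

lemma closure_U_set_reflect:
  assumes "y \<in> closure (U_set M q)"
  shows "top_val - y \<in> closure (U_set M q)"
  unfolding closure_approachable
proof (intro allI impI)
  fix \<epsilon> :: real assume "\<epsilon> > 0"
  then obtain z where "z \<in> U_set M q" "dist z y < \<epsilon>"
    using assms unfolding closure_approachable by blast
  then show "\<exists>z\<in>U_set M q. dist z (top_val - y) < \<epsilon>"
    using U_set_reflect by (intro bexI[of _ "top_val - z"]) (auto simp: dist_real_def)
qed

lemma closure_U_set_iff:
  assumes "0 \<le> x" "x \<le> top_val"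
  shows "x \<in> closure (U_set M q) \<longleftrightarrow>
       (\<exists>!c. is_expansion M q x c \<and> infinite_seq c) \<or>
       (\<exists>!c. is_expansion M q (top_val - x) c \<and> infinite_seq c)"
  using closure_U_set_imp[OF assms] unique_infinite_imp_closure[of x]
    unique_infinite_imp_closure[of "top_val - x"] closure_U_set_reflect[of "top_val - x"]
  by auto

end

theorem theorem7p2:
  fixes M :: nat and q x :: real
  assumes "M > 0"
    and "1 < q" and "q \<le> real M + 1"
    and "x \<in> J_set M q"
  shows "(x \<in> U_set M q \<longleftrightarrow> (\<exists>!c. is_expansion M q x c)) \<and>
    (x \<in> closure (U_set M q) \<longleftrightarrow>
       (\<exists>!c. is_expansion M q x c \<and> infinite_seq c) \<or>
       (\<exists>!c. is_expansion M q (real M / (q - 1) - x) c \<and> infinite_seq c)) \<and>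
    (x \<in> V_set M q \<longleftrightarrow>
       (\<exists>\<^sub>\<le>\<^sub>1c. is_expansion M q x c \<and> doubly_infinite_seq M c))"
proof -
  interpret expansion_base M q using assms by unfold_locales
  have x: "0 \<le> x" "x \<le> real M / (q - 1)" using assms(4) unfolding J_set_def by auto
  have "x \<in> U_set M q \<longleftrightarrow> (\<exists>!c. is_expansion M q x c)"
    using assms(4) unfolding U_set_def by simp
  then show ?thesis using closure_U_set_iff[OF x] V_set_iff[OF x] by blast
qed

end
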